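(* (1) Let $(X,\mathbf{T})$ be a free $\mathbb{Z}^{d_1}$-odometer and suppose $\mathbf{S}:\mathbb{Z}^{d_2}\curvearrowright X$ is a minimal bounded speedup of $\mathbf{T}$. Then $(X,\mathbf{S})$ is a free $\mathbb{Z}^{d_2}$-odometer. (2) In this situation $(X,\mathbf{S})$ is not necessarily conjugate to $(X,\mathbf{T})$: there exist $d$, a free $\mathbb{Z}^{d}$-odometer $(X,\mathbf{T})$ and a minimal bounded speedup $\mathbf{S}:\mathbb{Z}^{d}\curvearrowright X$ of $\mathbf{T}$ such that $(X,\mathbf{S})$ is not conjugate to $(X,\mathbf{T})$.
   Context: A $\mathbb{Z}^d$-action $\mathbf{T}:\mathbb{Z}^d\curvearrowright X$ on a topological space $X$ assigns to each $\mathbf{v}\in\mathbb{Z}^d$ a homeomorphism $\mathbf{T}^{\mathbf{v}}:X\to X$ with $\mathbf{T}^{\mathbf{v}+\mathbf{w}}=\mathbf{T}^{\mathbf{v}}\circ\mathbf{T}^{\mathbf{w}}$ and $\mathbf{T}^{\mathbf{0}}=\mathrm{id}$. It is free if $\mathbf{T}^{\mathbf{v}}(x)=x$ for some $x$ implies $\mathbf{v}=\mathbf{0}$, and minimal if every orbit is dense. Actions $\mathbf{T}:\mathbb{Z}^d\curvearrowright X$ and $\mathbf{S}:\mathbb{Z}^d\curvearrowright Y$ are conjugate if there is a homeomorphism $\Phi:X\to Y$ with $\Phi\circ\mathbf{T}^{\mathbf{v}}=\mathbf{S}^{\mathbf{v}}\circ\Phi$ for all $\mathbf{v}\in\mathbb{Z}^d$.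 A cocycle for $\mathbf{T}:\mathbb{Z}^{d_1}\curvearrowright X$ is a function $\mathbf{p}:X\times\mathbb{Z}^{d_2}\to\mathbb{Z}^{d_1}$ with $\mathbf{p}(x,\mathbf{0})=\mathbf{0}$ and $\mathbf{p}(x,\mathbf{v})+\mathbf{p}(\mathbf{T}^{\mathbf{p}(x,\mathbf{v})}(x),\mathbf{w})=\mathbf{p}(x,\mathbf{v}+\mathbf{w})$ for all $x\in X$ and $\mathbf{v},\mathbf{w}\in\mathbb{Z}^{d_2}$. A speedup of $(X,\mathbf{T})$ is an action (by homeomorphisms) $\mathbf{S}:\mathbb{Z}^{d_2}\curvearrowright X$ with $\mathbf{S}^{\mathbf{v}}(x)=\mathbf{T}^{\mathbf{p}(x,\mathbf{v})}(x)$ for some cocycle $\mathbf{p}$ for $\mathbf{T}$ (the speedup cocycle). The speedup is bounded if for each $\mathbf{v}\in\mathbb{Z}^{d_2}$ the set $\{\mathbf{p}(x,\mathbf{v}):x\in X\}$ is a bounded subset of $\mathbb{Z}^{d_1}$. Let $\mathfrak{G}=\{G_j\}_{j\ge1}$ be a decreasing sequence of finite-index subgroups of $\mathbb{Z}^d$, and let $X_{\mathfrak{G}}=\varprojlim\mathbb{Z}^d/G_j$ be the inverse limit along the quotient maps $\mathbb{Z}^d/G_{j+1}\to\mathbb{Z}^d/G_j$ (topologized as a subspace of the product of discrete spaces), with the action $\sigma_{\mathfrak{G}}^{\mathbf{v}}(\mathbf{x}_1,\mathbf{x}_2,\dots)=(\mathbf{x}_1+\mathbf{v},\mathbf{x}_2+\mathbf{v},\dots)$,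 the $j$-th coordinate taken mod $G_j$. A $\mathbb{Z}^d$-odometer is any $\mathbb{Z}^d$-action conjugate to some such $(X_{\mathfrak{G}},\sigma_{\mathfrak{G}})$.
   Formalization: In (1), S is proved to be an odometer, but free only if no nonzero vector acts as the identity; as stated freeness fails (S^{(a,b)} = T^a for a free Z-odometer T). In (2) the example S also has this property. *)

theory Defs
  imports
    "HOL-Analysis.Abstract_Topology"
    "HOL-Analysis.Function_Topology"
    "HOL-Library.Function_Algebras"
    "HOL-Algebra.Coset"
begin

text \<open>
  Since the dimension is quantified inside the statement, the group of integer vectors of
  length \<open>d\<close> is a carrier set rather than a type: integer sequences vanishing from index \<open>d\<close> on,
  with the pointwise operations of \<^theory>\<open>HOL-Library.Function_Algebras\<close>.
\<close>

definition Zd :: "nat \<Rightarrow> (nat \<Rightarrow> int) set" where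
  "Zd d = {v. \<forall>i\<ge>d. v i = 0}"

definition Zd_group :: "nat \<Rightarrow> (nat \<Rightarrow> int) monoid" where
  "Zd_group d = \<lparr>carrier = Zd d, monoid.mult = (+), one = 0\<rparr>"

lemma comm_group_Zd_group: "comm_group (Zd_group d)"
proof (rule comm_groupI)
  show "\<exists>y\<in>carrier (Zd_group d). y \<otimes>\<^bsub>Zd_group d\<^esub> x = \<one>\<^bsub>Zd_group d\<^esub>"
    if "x \<in> carrier (Zd_group d)" for x
    using that by (intro bexI[of _ "\<lambda>i. - x i"]) (auto simp: Zd_group_def Zd_def fun_eq_iff)
qed (auto simp: Zd_group_def Zd_def add_ac)

text \<open>
  An action is a map \<open>T\<close> with \<open>T v\<close> the homeomorphism of the vector \<open>v\<close>. Only the values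
  \<open>T v x\<close> with \<open>v \<in> Zd d\<close> and \<open>x\<close> in the space are relevant.
\<close>

definition is_action ::
  "nat \<Rightarrow> 'a topology \<Rightarrow> ((nat \<Rightarrow> int) \<Rightarrow> 'a \<Rightarrow> 'a) \<Rightarrow> bool" where
  "is_action d X T \<longleftrightarrow>
     (\<forall>v\<in>Zd d. homeomorphic_map X X (T v)) \<and>
     (\<forall>v\<in>Zd d. \<forall>w\<in>Zd d. \<forall>x\<in>topspace X. T (v + w) x = T v (T w x)) \<and>
     (\<forall>x\<in>topspace X. T 0 x = x)"

definition free_action ::
  "nat \<Rightarrow> 'a topology \<Rightarrow> ((nat \<Rightarrow> int) \<Rightarrow> 'a \<Rightarrow> 'a) \<Rightarrow> bool" where
  "free_action d X T \<longleftrightarrow> (\<forall>v\<in>Zd d. (\<exists>x\<in>topspace X. T v x = x) \<longrightarrow> v = 0)"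

text \<open>
  An action is effective if only the zero vector acts as the identity. A speedup of a free action
  need not be effective, even if it is minimal and bounded: for a minimal \<open>T\<close> of dimension 1, the
  speedup of dimension 2 with cocycle \<open>p x (a, b) = a\<close> is minimal, and \<open>(0, 1)\<close> acts trivially.
\<close>

definition effective_action ::
  "nat \<Rightarrow> 'a topology \<Rightarrow> ((nat \<Rightarrow> int) \<Rightarrow> 'a \<Rightarrow> 'a) \<Rightarrow> bool" where
  "effective_action d X T \<longleftrightarrow> (\<forall>v\<in>Zd d. (\<forall>x\<in>topspace X. T v x = x) \<longrightarrow> v = 0)"

definition minimal_action ::
  "nat \<Rightarrow> 'a topology \<Rightarrow> ((nat \<Rightarrow> int) \<Rightarrow> 'a \<Rightarrow> 'a) \<Rightarrow> bool" where
  "minimal_action d X T \<longleftrightarrow>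
     (\<forall>x\<in>topspace X. X closure_of ((\<lambda>v. T v x) ` Zd d) = topspace X)"

definition conjugate_actions ::
  "nat \<Rightarrow> 'a topology \<Rightarrow> ((nat \<Rightarrow> int) \<Rightarrow> 'a \<Rightarrow> 'a) \<Rightarrow>
     'b topology \<Rightarrow> ((nat \<Rightarrow> int) \<Rightarrow> 'b \<Rightarrow> 'b) \<Rightarrow> bool" where
  "conjugate_actions d X T Y S \<longleftrightarrow>
     (\<exists>\<Phi>. homeomorphic_map X Y \<Phi> \<and>
          (\<forall>v\<in>Zd d. \<forall>x\<in>topspace X. \<Phi> (T v x) = S v (\<Phi> x)))"

definition is_cocycle ::
  "nat \<Rightarrow> nat \<Rightarrow> 'a topology \<Rightarrow> ((nat \<Rightarrow> int) \<Rightarrow> 'a \<Rightarrow> 'a) \<Rightarrow>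
     ('a \<Rightarrow> (nat \<Rightarrow> int) \<Rightarrow> (nat \<Rightarrow> int)) \<Rightarrow> bool" where
  "is_cocycle d1 d2 X T p \<longleftrightarrow>
     (\<forall>x\<in>topspace X. (\<forall>v\<in>Zd d2. p x v \<in> Zd d1) \<and> p x 0 = 0 \<and>
        (\<forall>v\<in>Zd d2. \<forall>w\<in>Zd d2. p x v + p (T (p x v) x) w = p x (v + w)))"

definition is_speedup_via ::
  "nat \<Rightarrow> nat \<Rightarrow> 'a topology \<Rightarrow> ((nat \<Rightarrow> int) \<Rightarrow> 'a \<Rightarrow> 'a) \<Rightarrow>
     ((nat \<Rightarrow> int) \<Rightarrow> 'a \<Rightarrow> 'a) \<Rightarrow> ('a \<Rightarrow> (nat \<Rightarrow> int) \<Rightarrow> (nat \<Rightarrow> int)) \<Rightarrow> bool" where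
  "is_speedup_via d1 d2 X T S p \<longleftrightarrow>
     is_action d2 X S \<and> is_cocycle d1 d2 X T p \<and>
     (\<forall>v\<in>Zd d2. \<forall>x\<in>topspace X. S v x = T (p x v) x)"

definition bounded_speedup ::
  "nat \<Rightarrow> nat \<Rightarrow> 'a topology \<Rightarrow> ((nat \<Rightarrow> int) \<Rightarrow> 'a \<Rightarrow> 'a) \<Rightarrow>
     ((nat \<Rightarrow> int) \<Rightarrow> 'a \<Rightarrow> 'a) \<Rightarrow> bool" where
  "bounded_speedup d1 d2 X T S \<longleftrightarrow>
     (\<exists>p. is_speedup_via d1 d2 X T S p \<and>
          (\<forall>v\<in>Zd d2. \<exists>B. \<forall>x\<in>topspace X. \<forall>i<d1. \<bar>p x v i\<bar> \<le> B))"

definition subgroup_chain :: "nat \<Rightarrow> (nat \<Rightarrow> (nat \<Rightarrow> int) set) \<Rightarrow> bool" where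
  "subgroup_chain d G \<longleftrightarrow>
     (\<forall>j. subgroup (G j) (Zd_group d) \<and> finite (rcosets\<^bsub>Zd_group d\<^esub> (G j)) \<and> G (Suc j) \<subseteq> G j)"

text \<open>
  The inverse limit of the finite quotients. The quotient map from cosets of \<open>G (Suc j)\<close> to
  cosets of \<open>G j\<close> sends \<open>C\<close> to the set sum \<open>G j + C\<close>, because \<open>G (Suc j) \<subseteq> G j\<close>.
\<close>

definition odometer_space ::
  "nat \<Rightarrow> (nat \<Rightarrow> (nat \<Rightarrow> int) set) \<Rightarrow> (nat \<Rightarrow> (nat \<Rightarrow> int) set) topology" where
  "odometer_space d G =
     subtopology
       (product_topology (\<lambda>j. discrete_topology (rcosets\<^bsub>Zd_group d\<^esub> (G j))) UNIV)
       {x. \<forall>j. G j <#>\<^bsub>Zd_group d\<^esub> x (Suc j) = x j}"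

definition odometer_action ::
  "nat \<Rightarrow> (nat \<Rightarrow> int) \<Rightarrow> (nat \<Rightarrow> (nat \<Rightarrow> int) set) \<Rightarrow> (nat \<Rightarrow> (nat \<Rightarrow> int) set)" where
  "odometer_action d v x = (\<lambda>j. x j #>\<^bsub>Zd_group d\<^esub> v)"

definition is_odometer ::
  "nat \<Rightarrow> 'a topology \<Rightarrow> ((nat \<Rightarrow> int) \<Rightarrow> 'a \<Rightarrow> 'a) \<Rightarrow> bool" where
  "is_odometer d X T \<longleftrightarrow>
     is_action d X T \<and>
     (\<exists>G. subgroup_chain d G \<and>
          conjugate_actions d X T (odometer_space d G) (odometer_action d))"

end

theory Submission
  imports Defs "HOL-Analysis.Abstract_Topological_Spaces"
begin

text \<open>
  An odometer is the inverse limit of its actions on the finite sets \<open>\<int>^d / G j\<close>, and this shape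
  survives a bounded speedup. Let \<open>p\<close> be the speedup cocycle. For fixed \<open>v\<close> the function \<open>p _ v\<close>
  takes finitely many values, and because \<open>T\<close> is free, the set where it takes the value \<open>u\<close> is the
  set where \<open>T u\<close> and \<open>S v\<close> agree, which is closed. Hence \<open>p _ v\<close> is locally constant, and by
  compactness it is a function of a single coordinate of the point
  (\<open>free_bounded_cocycle_continuous\<close>, \<open>tower_locally_constant\<close>). Since \<open>\<int>^d2\<close> is generated by
  finitely many vectors, one coordinate \<open>n\<close> serves all generators. From coordinate \<open>n\<close> on, \<open>S\<close>
  therefore moves the \<open>m\<close>-th coordinate of a point in a way that depends only on that
  coordinate, so that \<open>S\<close> acts on each finite set of \<open>m\<close>-th coordinates; minimality makes these
  actions transitive. A transitive action of \<open>\<int>^d2\<close> on a finite set is the action on the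
  cosets of the stabiliser of a point, and the stabilisers along one point form the chain of
  subgroups that exhibits \<open>S\<close> as an odometer (\<open>invariant_tower_imp_odometer\<close>). That an
  effective \<open>S\<close> is free has nothing to do with odometers: it holds for every minimal action of a
  commutative group on a Hausdorff space (\<open>minimal_effective_imp_free\<close>).

  For the second part, take the product of the 2-adic and the 3-adic odometer, acted upon by
  \<open>\<int>^2\<close> coordinatewise, and let \<open>S\<close> be the same action with the two coordinates of the acting
  vector exchanged. It has the same orbits, and its cocycle does not depend on the point. The
  vectors \<open>(2^n, 0)\<close> tend to the identity under \<open>T\<close>; under \<open>S\<close> they translate the 3-adic factor by
  \<open>2^n\<close>, which is never divisible by 3 (\<open>swapped_odometer_not_conjugate\<close>).
\<close>

section \<open>Integer vectors and their cosets\<close>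

lemma Zd_zero [simp]: "0 \<in> Zd d"
  by (simp add: Zd_def)

lemma Zd_add [intro]: "v \<in> Zd d \<Longrightarrow> w \<in> Zd d \<Longrightarrow> v + w \<in> Zd d"
  by (simp add: Zd_def)

lemma Zd_uminus [intro]: "v \<in> Zd d \<Longrightarrow> - v \<in> Zd d"
  by (simp add: Zd_def)

lemma Zd_diff [intro]: "v \<in> Zd d \<Longrightarrow> w \<in> Zd d \<Longrightarrow> v - w \<in> Zd d"
  by (simp add: Zd_def)

lemma finite_Zd_box:
  assumes "\<And>i. i < d \<Longrightarrow> finite (A i)"
  shows "finite {v \<in> Zd d. \<forall>i<d. v i \<in> A i}"
proof -
  have "inj_on (\<lambda>v. restrict v {..<d}) (Zd d)"
  proof (rule inj_onI)
    fix v w assume vw: "v \<in> Zd d" "w \<in> Zd d" "restrict v {..<d} = restrict w {..<d}"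
    show "v = w"
    proof
      fix i
      show "v i = w i"
      proof (cases "i < d")
        case True
        then show ?thesis using fun_cong[OF vw(3), of i] by simp
      next
        case False
        then show ?thesis using vw by (simp add: Zd_def)
      qed
    qed
  qed
  then have inj: "inj_on (\<lambda>v. restrict v {..<d}) {v \<in> Zd d. \<forall>i<d. v i \<in> A i}"
    by (rule inj_on_subset) auto
  have fin: "finite (\<Pi>\<^sub>E i\<in>{..<d}. A i)"
    using assms by (intro finite_PiE) auto
  show ?thesis
    by (rule inj_on_finite[OF inj _ fin]) (auto split: if_splits)
qed

definition unit_vec :: "nat \<Rightarrow> nat \<Rightarrow> int" where
  "unit_vec i = (\<lambda>k. if k = i then 1 else 0)"

lemma unit_vec_Zd: "i < d \<Longrightarrow> unit_vec i \<in> Zd d"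
  by (auto simp: unit_vec_def Zd_def)

text \<open>
  The unit vectors and their negatives generate the group as a monoid; a statement known for
  finitely many vectors and stable under composition therefore extends to all of them.
\<close>

lemma Zd_induct [consumes 1, case_names zero plus minus]:
  assumes "v \<in> Zd d"
    and zero: "P 0"
    and plus: "\<And>v i. v \<in> Zd d \<Longrightarrow> i < d \<Longrightarrow> P v \<Longrightarrow> P (v + unit_vec i)"
    and minus: "\<And>v i. v \<in> Zd d \<Longrightarrow> i < d \<Longrightarrow> P v \<Longrightarrow> P (v - unit_vec i)"
  shows "P v"
  using assms(1)
proof (induction "\<Sum>i<d. nat \<bar>v i\<bar>" arbitrary: v rule: less_induct)
  case less
  show ?case
  proof (cases "v = 0")
    case True
    then show ?thesis using zero by simp
  next
    case False
    then obtain i where i: "v i \<noteq> 0" by (auto simp: fun_eq_iff)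
    with less.prems have "i < d" by (auto simp: Zd_def intro: ccontr)
    define w where "w = (if v i > 0 then v - unit_vec i else v + unit_vec i)"
    have w: "w \<in> Zd d" using less.prems unit_vec_Zd[OF \<open>i < d\<close>] by (auto simp: w_def)
    have "(\<Sum>k<d. nat \<bar>w k\<bar>) < (\<Sum>k<d. nat \<bar>v k\<bar>)"
      by (rule sum_strict_mono_ex1) (use i \<open>i < d\<close> in \<open>auto simp: w_def unit_vec_def\<close>)
    from less.hyps[OF this w] have "P w" .
    then show ?thesis
      using plus[OF w \<open>i < d\<close>] minus[OF w \<open>i < d\<close>] by (auto simp: w_def split: if_splits)
  qed
qed

lemma r_coset_Zd: "C #>\<^bsub>Zd_group d\<^esub> v = {u + v | u. u \<in> C}"
  by (auto simp: r_coset_def Zd_group_def)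

lemma set_mult_Zd: "A <#>\<^bsub>Zd_group d\<^esub> B = {u + v | u v. u \<in> A \<and> v \<in> B}"
  by (auto simp: set_mult_def Zd_group_def)

lemma rcosets_Zd: "rcosets\<^bsub>Zd_group d\<^esub> H = (\<lambda>v. H #>\<^bsub>Zd_group d\<^esub> v) ` Zd d"
  by (auto simp: RCOSETS_def Zd_group_def)

lemma mem_r_coset_Zd: "u \<in> C #>\<^bsub>Zd_group d\<^esub> v \<longleftrightarrow> u - v \<in> C"
  unfolding r_coset_Zd by (auto intro: exI[of _ "u - v"])

lemma r_coset_Zd_add: "C #>\<^bsub>Zd_group d\<^esub> v #>\<^bsub>Zd_group d\<^esub> w = C #>\<^bsub>Zd_group d\<^esub> (v + w)"
  by (auto simp: mem_r_coset_Zd algebra_simps)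

lemma r_coset_Zd_zero [simp]: "C #>\<^bsub>Zd_group d\<^esub> 0 = C"
  by (auto simp: mem_r_coset_Zd)

lemma set_mult_r_coset_Zd:
  "A <#>\<^bsub>Zd_group d\<^esub> (B #>\<^bsub>Zd_group d\<^esub> v) = (A <#>\<^bsub>Zd_group d\<^esub> B) #>\<^bsub>Zd_group d\<^esub> v"
  unfolding set_mult_Zd r_coset_Zd by (auto simp: add.assoc) (metis add.assoc)+

lemma subgroup_Zd_iff:
  "subgroup H (Zd_group d) \<longleftrightarrow>
     H \<subseteq> Zd d \<and> 0 \<in> H \<and> (\<forall>u\<in>H. \<forall>v\<in>H. u + v \<in> H) \<and> (\<forall>u\<in>H. - u \<in> H)"
proof -
  interpret comm_group "Zd_group d" by (rule comm_group_Zd_group)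
  have inv: "inv\<^bsub>Zd_group d\<^esub> u = - u" if "u \<in> Zd d" for u
    by (rule inv_equality) (use that in \<open>auto simp: Zd_group_def\<close>)
  show ?thesis
  proof
    assume H: "subgroup H (Zd_group d)"
    have "H \<subseteq> Zd d" using subgroup.subset[OF H] by (simp add: Zd_group_def)
    then show "H \<subseteq> Zd d \<and> 0 \<in> H \<and> (\<forall>u\<in>H. \<forall>v\<in>H. u + v \<in> H) \<and> (\<forall>u\<in>H. - u \<in> H)"
      using subgroup.one_closed[OF H] subgroup.m_closed[OF H] subgroup.m_inv_closed[OF H] inv
      by (auto simp: Zd_group_def subset_iff)
  next
    assume H: "H \<subseteq> Zd d \<and> 0 \<in> H \<and> (\<forall>u\<in>H. \<forall>v\<in>H. u + v \<in> H) \<and> (\<forall>u\<in>H. - u \<in> H)"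
    then show "subgroup H (Zd_group d)"
      using inv by (intro subgroup.intro) (auto simp: Zd_group_def subset_iff)
  qed
qed

lemma set_mult_Zd_subgroups:
  assumes "subgroup H (Zd_group d)" "subgroup K (Zd_group d)" "K \<subseteq> H"
  shows "H <#>\<^bsub>Zd_group d\<^esub> K = H"
  using assms unfolding set_mult_Zd subgroup_Zd_iff
  by (auto simp: subset_iff) (metis add.right_neutral)

lemma r_coset_Zd_eq_iff:
  assumes "subgroup H (Zd_group d)"
  shows "H #>\<^bsub>Zd_group d\<^esub> v = H #>\<^bsub>Zd_group d\<^esub> w \<longleftrightarrow> v - w \<in> H"
proof
  have 0: "0 \<in> H" and add: "\<And>u v. u \<in> H \<Longrightarrow> v \<in> H \<Longrightarrow> u + v \<in> H"
    and neg: "\<And>u. u \<in> H \<Longrightarrow> - u \<in> H"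
    using assms by (auto simp: subgroup_Zd_iff)
  show "v - w \<in> H" if "H #>\<^bsub>Zd_group d\<^esub> v = H #>\<^bsub>Zd_group d\<^esub> w"
    using that 0 mem_r_coset_Zd[of v d H v] mem_r_coset_Zd[of v d H w] by simp
  show "H #>\<^bsub>Zd_group d\<^esub> v = H #>\<^bsub>Zd_group d\<^esub> w" if vw: "v - w \<in> H"
  proof (rule Set.set_eqI)
    fix u
    show "u \<in> H #>\<^bsub>Zd_group d\<^esub> v \<longleftrightarrow> u \<in> H #>\<^bsub>Zd_group d\<^esub> w"
      using add[OF _ vw, of "u - v"] add[OF _ neg[OF vw], of "u - w"]
      by (auto simp: mem_r_coset_Zd)
  qed
qed

section \<open>Actions\<close>

lemma is_action_closed:
  "is_action d X T \<Longrightarrow> v \<in> Zd d \<Longrightarrow> x \<in> topspace X \<Longrightarrow> T v x \<in> topspace X"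
  unfolding is_action_def by (metis homeomorphic_imp_surjective_map imageI)

lemma is_action_add:
  "is_action d X T \<Longrightarrow> v \<in> Zd d \<Longrightarrow> w \<in> Zd d \<Longrightarrow> x \<in> topspace X \<Longrightarrow> T (v + w) x = T v (T w x)"
  unfolding is_action_def by blast

lemma is_action_zero: "is_action d X T \<Longrightarrow> x \<in> topspace X \<Longrightarrow> T 0 x = x"
  unfolding is_action_def by blast

lemma is_action_continuous: "is_action d X T \<Longrightarrow> v \<in> Zd d \<Longrightarrow> continuous_map X X (T v)"
  unfolding is_action_def by (blast intro: homeomorphic_imp_continuous_map)

lemma minimal_actionE:
  assumes "minimal_action d X T" "openin X U" "y \<in> U" "x \<in> topspace X"
  obtains v where "v \<in> Zd d" "T v x \<in> U"
proof -
  have "y \<in> X closure_of ((\<lambda>v. T v x) ` Zd d)"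
    using assms openin_subset unfolding minimal_action_def by blast
  then show ?thesis
    using assms that unfolding in_closure_of by blast
qed

text \<open>
  The group is commutative, so a vector fixing one point fixes its whole orbit, and an orbit of
  a minimal action is dense.
\<close>

lemma minimal_effective_imp_free:
  assumes T: "is_action d X T" and "Hausdorff_space X"
    and min: "minimal_action d X T" and eff: "effective_action d X T"
  shows "free_action d X T"
  unfolding free_action_def
proof (intro ballI impI)
  fix v assume v: "v \<in> Zd d" and "\<exists>x\<in>topspace X. T v x = x"
  then obtain x where x: "x \<in> topspace X" "T v x = x" by blast
  let ?F = "{y \<in> topspace X. T v y = y}"
  have closed: "closedin X ?F"
    using closedin_continuous_maps_eq[OF assms(2) is_action_continuous[OF T v], of id] by simp
  have "T v (T w x) = T w x" if w: "w \<in> Zd d" for w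
    using is_action_add[OF T v w x(1)] is_action_add[OF T w v x(1)] x(2)
    by (simp add: add.commute)
  then have "(\<lambda>w. T w x) ` Zd d \<subseteq> ?F"
    using is_action_closed[OF T _ x(1)] by auto
  then have "topspace X \<subseteq> ?F"
    using closure_of_minimal[OF _ closed] min x(1) unfolding minimal_action_def by blast
  with eff v show "v = 0" unfolding effective_action_def by blast
qed

section \<open>Towers of finite partitions\<close>

text \<open>
  The maps \<open>\<pi> n\<close> stand for a sequence of finer and finer clopen partitions that together
  separate points, the intrinsic form of an inverse limit of finite sets. The coordinates of an
  odometer are the model case. Speaking of partitions of \<open>X\<close> itself allows the same sequence
  to be used for several actions on \<open>X\<close>.
\<close>

definition tower :: "'a topology \<Rightarrow> (nat \<Rightarrow> 'a \<Rightarrow> 'b) \<Rightarrow> bool" where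
  "tower X \<pi> \<longleftrightarrow>
     compact_space X \<and>
     (\<forall>n. continuous_map X (discrete_topology UNIV) (\<pi> n)) \<and>
     (\<forall>n. \<forall>x\<in>topspace X. \<forall>y\<in>topspace X. \<pi> (Suc n) x = \<pi> (Suc n) y \<longrightarrow> \<pi> n x = \<pi> n y) \<and>
     (\<forall>x\<in>topspace X. \<forall>y\<in>topspace X. (\<forall>n. \<pi> n x = \<pi> n y) \<longrightarrow> x = y)"

lemma tower_compact: "tower X \<pi> \<Longrightarrow> compact_space X"
  unfolding tower_def by blast

lemma tower_continuous: "tower X \<pi> \<Longrightarrow> continuous_map X (discrete_topology UNIV) (\<pi> n)"
  unfolding tower_def by blast

lemma tower_separates:
  "tower X \<pi> \<Longrightarrow> x \<in> topspace X \<Longrightarrow> y \<in> topspace X \<Longrightarrow> (\<And>n. \<pi> n x = \<pi> n y) \<Longrightarrow> x = y"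
  unfolding tower_def by blast

lemma tower_refines:
  assumes "tower X \<pi>" "m \<le> n" "x \<in> topspace X" "y \<in> topspace X" "\<pi> n x = \<pi> n y"
  shows "\<pi> m x = \<pi> m y"
  using assms(2,5)
proof (induction rule: dec_induct)
  case (step k)
  then show ?case using assms(1,3,4) unfolding tower_def by blast
qed

lemma tower_open: "tower X \<pi> \<Longrightarrow> openin X {x \<in> topspace X. \<pi> n x \<in> B}"
  by (rule openin_continuous_map_preimage[where Y = "discrete_topology UNIV"])
     (simp_all add: tower_continuous)

lemma tower_closed: "tower X \<pi> \<Longrightarrow> closedin X {x \<in> topspace X. \<pi> n x \<in> B}"
  by (rule closedin_continuous_map_preimage[where Y = "discrete_topology UNIV"])
     (simp_all add: tower_continuous)

lemma tower_finite_range: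
  assumes "tower X \<pi>"
  shows "finite (\<pi> n ` topspace X)"
proof -
  have "compactin (discrete_topology UNIV) (\<pi> n ` topspace X)"
    using assms unfolding tower_def compact_space_def by (blast intro: image_compactin)
  then show ?thesis by (simp add: compactin_discrete_topology)
qed

lemma tower_Hausdorff:
  assumes "tower X \<pi>"
  shows "Hausdorff_space X"
  unfolding Hausdorff_space_def
proof (intro allI impI, elim conjE)
  fix x y assume "x \<in> topspace X" "y \<in> topspace X" "x \<noteq> y"
  moreover then obtain n where "\<pi> n x \<noteq> \<pi> n y"
    using tower_separates[OF assms] by blast
  ultimately show "\<exists>U V. openin X U \<and> openin X V \<and> x \<in> U \<and> y \<in> V \<and> disjnt U V"
    using tower_open[OF assms, of n "{\<pi> n x}"] tower_open[OF assms, of n "{\<pi> n y}"]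
    by (intro exI[of _ "{z \<in> topspace X. \<pi> n z \<in> {\<pi> n x}}"]
        exI[of _ "{z \<in> topspace X. \<pi> n z \<in> {\<pi> n y}}"]) (auto simp: disjnt_def)
qed

text \<open>
  By compactness, the cells around \<open>x\<close> form a neighbourhood basis: the parts of them outside
  \<open>U\<close> are closed and decreasing, with empty intersection.
\<close>

lemma tower_neighbourhood:
  assumes tw: "tower X \<pi>" and U: "openin X U" and x: "x \<in> U"
  obtains n where "\<And>y. y \<in> topspace X \<Longrightarrow> \<pi> n y = \<pi> n x \<Longrightarrow> y \<in> U"
proof -
  have xX: "x \<in> topspace X" using U x openin_subset by blast
  define C where "C n = {y \<in> topspace X. \<pi> n y \<in> {\<pi> n x}} - U" for n
  have "closedin X (C n)" for n
    unfolding C_def using tower_closed[OF tw] U by (intro closedin_diff)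
  moreover have "decseq C"
    unfolding decseq_def C_def using tower_refines[OF tw _ _ xX] by auto
  moreover have "(\<Inter>n. C n) = {}"
  proof (rule ccontr)
    assume "(\<Inter>n. C n) \<noteq> {}"
    then obtain y where "\<And>n. y \<in> C n" by blast
    then have "y \<in> topspace X" "y \<notin> U" "\<And>n. \<pi> n y = \<pi> n x" by (auto simp: C_def)
    with tower_separates[OF tw _ xX] x show False by blast
  qed
  ultimately obtain n where "C n = {}"
    using compact_space_imp_nest[OF tower_compact[OF tw]] by metis
  then show ?thesis by (intro that[of n]) (auto simp: C_def)
qed

text \<open>
  Here \<open>C n\<close> is the union of the cells of level \<open>n\<close> on which \<open>f\<close> is not constant. No point lies
  in all of these, since \<open>f\<close> is constant near every point, so compactness makes one of them empty.
\<close>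

lemma tower_locally_constant:
  assumes tw: "tower X \<pi>" and f: "continuous_map X (discrete_topology UNIV) f"
  obtains n where "\<And>m x y. n \<le> m \<Longrightarrow> x \<in> topspace X \<Longrightarrow> y \<in> topspace X \<Longrightarrow>
    \<pi> m x = \<pi> m y \<Longrightarrow> f x = f y"
proof -
  \<comment> \<open>labels of the cells of level \<open>n\<close> on which \<open>f\<close> takes two values\<close>
  define B where
    "B n = {\<pi> n y | y z. y \<in> topspace X \<and> z \<in> topspace X \<and> \<pi> n y = \<pi> n z \<and> f y \<noteq> f z}" for n
  define C where "C n = {x \<in> topspace X. \<pi> n x \<in> B n}" for n
  have "closedin X (C n)" for n
    unfolding C_def by (rule tower_closed[OF tw])
  moreover have "decseq C"
  proof (rule decseq_SucI, rule subsetI)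
    fix n x assume "x \<in> C (Suc n)"
    then have "x \<in> topspace X" "\<pi> (Suc n) x \<in> B (Suc n)"
      by (simp_all add: C_def)
    then obtain y z where yz: "x \<in> topspace X" "y \<in> topspace X" "z \<in> topspace X"
      "\<pi> (Suc n) x = \<pi> (Suc n) y" "\<pi> (Suc n) y = \<pi> (Suc n) z" "f y \<noteq> f z"
      unfolding B_def by blast
    then have "\<pi> n x = \<pi> n y" "\<pi> n y = \<pi> n z"
      by (blast intro: tower_refines[OF tw le_SucI[OF order_refl]])+
    with yz show "x \<in> C n" unfolding C_def B_def by blast
  qed
  moreover have "(\<Inter>n. C n) = {}"
  proof (rule ccontr)
    assume "(\<Inter>n. C n) \<noteq> {}"
    then obtain x where x: "\<And>n. x \<in> C n" by blast
    then have xX: "x \<in> topspace X" by (auto simp: C_def)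
    have "openin X {z \<in> topspace X. f z \<in> {f x}}"
      by (rule openin_continuous_map_preimage[OF f]) simp
    moreover have "x \<in> {z \<in> topspace X. f z \<in> {f x}}"
      using xX by simp
    ultimately obtain n where
      "\<And>y. y \<in> topspace X \<Longrightarrow> \<pi> n y = \<pi> n x \<Longrightarrow> y \<in> {z \<in> topspace X. f z \<in> {f x}}"
      using tower_neighbourhood[OF tw] by metis
    then have const: "f y = f x" if "y \<in> topspace X" "\<pi> n y = \<pi> n x" for y
      using that by blast
    have "\<pi> n x \<in> B n"
      using x[of n] by (simp add: C_def)
    then obtain y z where "y \<in> topspace X" "z \<in> topspace X" "\<pi> n x = \<pi> n y" "\<pi> n y = \<pi> n z"
      "f y \<noteq> f z"
      unfolding B_def by blast
    with const show False by metis
  qed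
  ultimately obtain n where "C n = {}"
    using compact_space_imp_nest[OF tower_compact[OF tw]] by metis
  then have "f x = f y" if "x \<in> topspace X" "y \<in> topspace X" "\<pi> n x = \<pi> n y" for x y
    using that unfolding C_def B_def by blast
  with tower_refines[OF tw] show ?thesis by (intro that[of n]) blast
qed

lemma tower_shift:
  assumes tw: "tower X \<pi>"
  shows "tower X (\<lambda>j. \<pi> (n + j))"
proof -
  have "x = y" if "x \<in> topspace X" "y \<in> topspace X" "\<forall>j. \<pi> (n + j) x = \<pi> (n + j) y" for x y
    using tower_separates[OF tw that(1,2)] tower_refines[OF tw le_add2 that(1,2)] that(3) by blast
  then show ?thesis
    using tw unfolding tower_def add_Suc_right by blast
qed

lemma tower_pullback:
  assumes \<Phi>: "homeomorphic_map X Y \<Phi>" and tw: "tower Y \<pi>"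
  shows "tower X (\<lambda>n x. \<pi> n (\<Phi> x))"
proof -
  have "compact_space X"
    using \<Phi> tw homeomorphic_compact_space homeomorphic_map_imp_homeomorphic_space
    unfolding tower_def by blast
  moreover have "continuous_map X (discrete_topology UNIV) (\<lambda>x. \<pi> n (\<Phi> x))" for n
    using continuous_map_compose[OF homeomorphic_imp_continuous_map[OF \<Phi>], of _ "\<pi> n"] tw
    unfolding tower_def comp_def by blast
  moreover have "\<Phi> x \<in> topspace Y" if "x \<in> topspace X" for x
    using homeomorphic_imp_surjective_map[OF \<Phi>] that by blast
  moreover have "inj_on \<Phi> (topspace X)"
    by (rule homeomorphic_imp_injective_map[OF \<Phi>])
  ultimately show ?thesis
    using tw unfolding tower_def inj_on_def by blast
qed

section \<open>Odometers\<close>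

lemma subgroup_chain_subgroup: "subgroup_chain d G \<Longrightarrow> subgroup (G j) (Zd_group d)"
  by (simp add: subgroup_chain_def)

lemma topspace_odometer:
  "topspace (odometer_space d G) =
     {x. (\<forall>j. x j \<in> rcosets\<^bsub>Zd_group d\<^esub> (G j)) \<and>
         (\<forall>j. G j <#>\<^bsub>Zd_group d\<^esub> x (Suc j) = x j)}"
  by (auto simp: odometer_space_def PiE_iff)

lemma odometer_cosetE:
  assumes "x \<in> topspace (odometer_space d G)"
  obtains v where "v \<in> Zd d" "x j = G j #>\<^bsub>Zd_group d\<^esub> v"
  using assms unfolding topspace_odometer rcosets_Zd by blast

lemma continuous_map_odometer_coordinate:
  "continuous_map (odometer_space d G) (discrete_topology (rcosets\<^bsub>Zd_group d\<^esub> (G j))) (\<lambda>x. x j)"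
  unfolding odometer_space_def
  by (intro continuous_map_from_subtopology continuous_map_product_projection) simp

lemma continuous_map_into_odometer:
  assumes "\<And>x. x \<in> topspace X \<Longrightarrow> f x \<in> topspace (odometer_space d G)"
    and "\<And>j. continuous_map X (discrete_topology (rcosets\<^bsub>Zd_group d\<^esub> (G j))) (\<lambda>x. f x j)"
  shows "continuous_map X (odometer_space d G) f"
  using assms unfolding topspace_odometer
  by (auto simp: odometer_space_def continuous_map_in_subtopology continuous_map_componentwise_UNIV)

lemma Hausdorff_odometer: "Hausdorff_space (odometer_space d G)"
  unfolding odometer_space_def
  by (intro Hausdorff_space_subtopology) (auto simp: Hausdorff_space_product_topology)

text \<open>
  The coherence conditions are equalisers of continuous maps into discrete spaces, so they cut out
  a closed subset of a product of finite spaces.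
\<close>

lemma compact_odometer:
  assumes "subgroup_chain d G"
  shows "compact_space (odometer_space d G)"
proof -
  let ?P = "product_topology (\<lambda>j. discrete_topology (rcosets\<^bsub>Zd_group d\<^esub> (G j))) UNIV"
  let ?E = "\<lambda>j. {x \<in> topspace ?P. G j <#>\<^bsub>Zd_group d\<^esub> x (Suc j) = x j}"
  have "continuous_map ?P (discrete_topology UNIV) (\<lambda>x. F (x j))"
    for j and F :: "(nat \<Rightarrow> int) set \<Rightarrow> (nat \<Rightarrow> int) set"
    using continuous_map_compose[OF continuous_map_product_projection[of j UNIV
          "\<lambda>j. discrete_topology (rcosets\<^bsub>Zd_group d\<^esub> (G j))"], of "discrete_topology UNIV" F]
    by (simp add: comp_def)
  from this[of "\<lambda>C. C"] this have "closedin ?P (?E j)" for j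
    by (intro closedin_continuous_maps_eq[of "discrete_topology UNIV"]) auto
  then have "closedin ?P (\<Inter>j. ?E j)" by blast
  moreover have "compact_space ?P"
    using assms by (simp add: compact_space_product_topology compact_space_discrete_topology
        subgroup_chain_def)
  ultimately have "compact_space (subtopology ?P (\<Inter>j. ?E j))"
    by (intro compact_space_subtopology closedin_compact_space)
  moreover have "odometer_space d G = subtopology ?P (\<Inter>j. ?E j)"
    unfolding odometer_space_def
    by (subst subtopology_restrict[symmetric]) (auto intro!: arg_cong[of _ _ "subtopology ?P"])
  ultimately show ?thesis by simp
qed

lemma tower_odometer:
  assumes "subgroup_chain d G"
  shows "tower (odometer_space d G) (\<lambda>j x. x j)"
proof -
  have "continuous_map (odometer_space d G) (discrete_topology UNIV) (\<lambda>x. x j)" for j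
    using continuous_map_odometer_coordinate[of d G j]
      continuous_map_into_fulltopology[of _ "discrete_topology UNIV" "rcosets\<^bsub>Zd_group d\<^esub> (G j)"]
    by (simp add: subtopology_discrete_topology)
  moreover have "x j = y j"
    if "x \<in> topspace (odometer_space d G)" "y \<in> topspace (odometer_space d G)"
      "x (Suc j) = y (Suc j)" for x y j
    using that by (metis (mono_tags, lifting) mem_Collect_eq topspace_odometer)
  ultimately show ?thesis
    unfolding tower_def using compact_odometer[OF assms] by (blast intro: ext)
qed


lemma odometer_base_point:
  assumes "subgroup_chain d G"
  shows "G \<in> topspace (odometer_space d G)"
proof -
  have "G j \<in> rcosets\<^bsub>Zd_group d\<^esub> (G j)" for j
    unfolding rcosets_Zd using r_coset_Zd_zero by (metis Zd_zero imageI)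
  moreover have "G j <#>\<^bsub>Zd_group d\<^esub> G (Suc j) = G j" for j
    using assms by (intro set_mult_Zd_subgroups) (auto simp: subgroup_chain_def)
  ultimately show ?thesis by (simp add: topspace_odometer)
qed

lemma odometer_action_closed:
  assumes "v \<in> Zd d" "x \<in> topspace (odometer_space d G)"
  shows "odometer_action d v x \<in> topspace (odometer_space d G)"
proof -
  have "x j #>\<^bsub>Zd_group d\<^esub> v \<in> rcosets\<^bsub>Zd_group d\<^esub> (G j)" for j
    using odometer_cosetE[OF assms(2), of j] assms(1)
    by (metis Zd_add imageI r_coset_Zd_add rcosets_Zd)
  then show ?thesis
    using assms(2) by (simp add: topspace_odometer odometer_action_def set_mult_r_coset_Zd)
qed

lemma odometer_action_is_action: "is_action d (odometer_space d G) (odometer_action d)"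
proof -
  let ?X = "odometer_space d G"
  have add: "odometer_action d v (odometer_action d w x) = odometer_action d (w + v) x" for v w x
    by (simp add: odometer_action_def r_coset_Zd_add)
  have zero: "odometer_action d 0 x = x" for x
    by (simp add: odometer_action_def)
  have cont: "continuous_map ?X ?X (odometer_action d v)" if v: "v \<in> Zd d" for v
  proof -
    have "continuous_map ?X (discrete_topology (rcosets\<^bsub>Zd_group d\<^esub> (G j)))
        (\<lambda>x. odometer_action d v x j)" for j
    proof -
      have "(\<lambda>C. C #>\<^bsub>Zd_group d\<^esub> v) ` (rcosets\<^bsub>Zd_group d\<^esub> (G j))
          \<subseteq> (rcosets\<^bsub>Zd_group d\<^esub> (G j))"
        using v by (auto simp: rcosets_Zd r_coset_Zd_add)
      then have "continuous_map (discrete_topology (rcosets\<^bsub>Zd_group d\<^esub> (G j)))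
          (discrete_topology (rcosets\<^bsub>Zd_group d\<^esub> (G j))) (\<lambda>C. C #>\<^bsub>Zd_group d\<^esub> v)"
        by (auto simp: image_subset_iff)
      from continuous_map_compose[OF continuous_map_odometer_coordinate[of d G j] this]
      show ?thesis by (simp add: comp_def odometer_action_def)
    qed
    then show ?thesis
      by (intro continuous_map_into_odometer odometer_action_closed[OF v])
  qed
  have "homeomorphic_map ?X ?X (odometer_action d v)" if v: "v \<in> Zd d" for v
  proof -
    have "homeomorphic_maps ?X ?X (odometer_action d v) (odometer_action d (- v))"
      unfolding homeomorphic_maps_def using v by (auto simp: cont[OF v] cont[OF Zd_uminus[OF v]] add zero)
    then show ?thesis by (rule homeomorphic_maps_imp_map)
  qed
  then show ?thesis
    unfolding is_action_def by (auto simp: add zero add.commute)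
qed

lemma odometer_is_odometer:
  assumes "subgroup_chain d G"
  shows "is_odometer d (odometer_space d G) (odometer_action d)"
proof -
  have "conjugate_actions d (odometer_space d G) (odometer_action d)
      (odometer_space d G) (odometer_action d)"
    unfolding conjugate_actions_def by (intro exI[of _ id]) simp
  with assms odometer_action_is_action show ?thesis
    unfolding is_odometer_def by blast
qed

lemma odometer_minimal:
  assumes G: "subgroup_chain d G"
  shows "minimal_action d (odometer_space d G) (odometer_action d)"
proof -
  let ?X = "odometer_space d G"
  have "\<exists>v\<in>Zd d. odometer_action d v x \<in> U"
    if x: "x \<in> topspace ?X" and y: "y \<in> U" and U: "openin ?X U" for x y U
  proof -
    obtain n where n: "\<And>z. z \<in> topspace ?X \<Longrightarrow> z n = y n \<Longrightarrow> z \<in> U"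
      using tower_neighbourhood[OF tower_odometer[OF G] U y] by metis
    have yX: "y \<in> topspace ?X" using U y openin_subset by blast
    obtain v where v: "v \<in> Zd d" "x n = G n #>\<^bsub>Zd_group d\<^esub> v" by (rule odometer_cosetE[OF x])
    obtain w where w: "w \<in> Zd d" "y n = G n #>\<^bsub>Zd_group d\<^esub> w" by (rule odometer_cosetE[OF yX])
    have "odometer_action d (w - v) x n = y n"
      by (simp add: odometer_action_def v w r_coset_Zd_add)
    with n odometer_action_closed[OF _ x] v w show ?thesis by blast
  qed
  then show ?thesis
    unfolding minimal_action_def
    by (intro ballI equalityI closure_of_subset_topspace subsetI) (auto simp: in_closure_of)
qed

text \<open>
  A vector fixing a point fixes all its coordinates, and a coset is fixed only by the vectors of
  its subgroup.
\<close>

lemma odometer_free: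
  assumes G: "subgroup_chain d G" and triv: "(\<Inter>j. G j) = {0}"
  shows "free_action d (odometer_space d G) (odometer_action d)"
  unfolding free_action_def
proof (intro ballI impI)
  fix v assume v: "v \<in> Zd d" and "\<exists>x\<in>topspace (odometer_space d G). odometer_action d v x = x"
  then obtain x where x: "x \<in> topspace (odometer_space d G)" "odometer_action d v x = x" by blast
  have "v \<in> G j" for j
  proof -
    obtain w where w: "x j = G j #>\<^bsub>Zd_group d\<^esub> w" by (rule odometer_cosetE[OF x(1)])
    have "G j #>\<^bsub>Zd_group d\<^esub> (w + v) = G j #>\<^bsub>Zd_group d\<^esub> w"
      using fun_cong[OF x(2), of j] w by (simp add: odometer_action_def r_coset_Zd_add)
    then show ?thesis
      using r_coset_Zd_eq_iff[OF subgroup_chain_subgroup[OF G]] by fastforce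
  qed
  with triv show "v = 0" by blast
qed

lemma is_odometer_Hausdorff: "is_odometer d X T \<Longrightarrow> Hausdorff_space X"
  unfolding is_odometer_def conjugate_actions_def
  using Hausdorff_odometer homeomorphic_Hausdorff_space homeomorphic_map_imp_homeomorphic_space
  by blast

section \<open>Recognising odometers\<close>

text \<open>
  An action that permutes the cells of every level of a tower is the inverse limit of its actions
  on the finite sets of cells. Minimality makes these transitive, so the set of cells of level \<open>j\<close>
  is identified with the cosets of the stabiliser \<open>G j\<close> of the cell of a base point \<open>x0\<close>: the cell
  of \<open>x\<close> corresponds to the coset \<open>\<Phi> x j\<close> of all vectors that carry \<open>x0\<close> into it. Compactness
  gives surjectivity of \<open>\<Phi>\<close>, because every coherent sequence of cells has a common point.
\<close>

theorem invariant_tower_imp_odometer: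
  assumes S: "is_action d X S" and min: "minimal_action d X S" and ne: "topspace X \<noteq> {}"
    and tw: "tower X \<pi>"
    and inv: "\<And>j v x y. v \<in> Zd d \<Longrightarrow> x \<in> topspace X \<Longrightarrow> y \<in> topspace X \<Longrightarrow>
      \<pi> j x = \<pi> j y \<Longrightarrow> \<pi> j (S v x) = \<pi> j (S v y)"
  shows "is_odometer d X S"
proof -
  obtain x0 where x0: "x0 \<in> topspace X" using ne by blast
  \<comment> \<open>\<open>K\<close> exhibits \<open>\<Phi> x j\<close> as a function of the label \<open>\<pi> j x\<close>, whence its continuity\<close>
  define K where "K j b = {v \<in> Zd d. \<pi> j (S v x0) = b}" for j b
  define \<Phi> where "\<Phi> x = (\<lambda>j. K j (\<pi> j x))" for x
  define G where "G = \<Phi> x0"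
  have mem: "v \<in> \<Phi> x j \<longleftrightarrow> v \<in> Zd d \<and> \<pi> j (S v x0) = \<pi> j x" for v x j
    by (simp add: \<Phi>_def K_def)
  have SX: "S v x \<in> topspace X" if "v \<in> Zd d" "x \<in> topspace X" for v x
    using is_action_closed[OF S that] .
  have shift: "\<Phi> (S v x) j = \<Phi> x j #>\<^bsub>Zd_group d\<^esub> v" if v: "v \<in> Zd d" and x: "x \<in> topspace X" for v x j
  proof (rule Set.set_eqI)
    fix u
    have "u \<in> Zd d \<and> \<pi> j (S u x0) = \<pi> j (S v x) \<longleftrightarrow> u - v \<in> Zd d \<and> \<pi> j (S (u - v) x0) = \<pi> j x"
    proof
      assume u: "u \<in> Zd d \<and> \<pi> j (S u x0) = \<pi> j (S v x)"
      then have "\<pi> j (S (- v) (S u x0)) = \<pi> j (S (- v) (S v x))"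
        using v x x0 SX by (intro inv) auto
      moreover have "S (- v) (S u x0) = S (u - v) x0"
        using is_action_add[OF S Zd_uminus[OF v], of u x0] u x0 by simp
      moreover have "S (- v) (S v x) = x"
        using is_action_add[OF S Zd_uminus[OF v] v x] is_action_zero[OF S x] by simp
      ultimately show "u - v \<in> Zd d \<and> \<pi> j (S (u - v) x0) = \<pi> j x"
        using u v by auto
    next
      assume u: "u - v \<in> Zd d \<and> \<pi> j (S (u - v) x0) = \<pi> j x"
      then have "\<pi> j (S v (S (u - v) x0)) = \<pi> j (S v x)"
        using v x x0 SX by (intro inv) auto
      moreover have "S v (S (u - v) x0) = S u x0"
        using is_action_add[OF S v, of "u - v" x0] u x0 by simp
      moreover have "u \<in> Zd d" using Zd_add[of "u - v" d v] u v by simp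
      ultimately show "u \<in> Zd d \<and> \<pi> j (S u x0) = \<pi> j (S v x)" by simp
    qed
    then show "u \<in> \<Phi> (S v x) j \<longleftrightarrow> u \<in> \<Phi> x j #>\<^bsub>Zd_group d\<^esub> v"
      by (simp only: mem mem_r_coset_Zd)
  qed
  have coset: "G j #>\<^bsub>Zd_group d\<^esub> v = \<Phi> (S v x0) j" if "v \<in> Zd d" for v j
    using shift[OF that x0] by (simp add: G_def)
  have approx: "\<exists>v\<in>Zd d. \<pi> j (S v x0) = \<pi> j x" if "x \<in> topspace X" for x j
    using minimal_actionE[OF min tower_open[OF tw, of j "{\<pi> j x}"] _ x0, of x] that by blast
  have mult: "G j <#>\<^bsub>Zd_group d\<^esub> \<Phi> x (Suc j) = \<Phi> x j" if x: "x \<in> topspace X" for x j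
  proof -
    have down: "u \<in> \<Phi> x j" if "u \<in> \<Phi> x (Suc j)" for u
      using that tower_refines[OF tw _ SX[OF _ x0] x, of j "Suc j"] by (auto simp: mem)
    obtain v where v: "v \<in> \<Phi> x (Suc j)" using approx[OF x, of "Suc j"] by (auto simp: mem)
    have eq: "\<Phi> x j = G j #>\<^bsub>Zd_group d\<^esub> u" if "u \<in> \<Phi> x j" for u
      using that coset[of u j] by (simp add: mem) (simp add: \<Phi>_def)
    show ?thesis
    proof (intro equalityI subsetI)
      fix w assume "w \<in> G j <#>\<^bsub>Zd_group d\<^esub> \<Phi> x (Suc j)"
      then obtain g u where "w = g + u" "g \<in> G j" "u \<in> \<Phi> x (Suc j)" by (auto simp: set_mult_Zd)
      then show "w \<in> \<Phi> x j" using eq[OF down, of u] by (auto simp: mem_r_coset_Zd)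
    next
      fix w assume "w \<in> \<Phi> x j"
      then have "w - v \<in> G j" using eq[OF down[OF v]] by (simp add: mem_r_coset_Zd)
      moreover have "w = (w - v) + v" by simp
      ultimately show "w \<in> G j <#>\<^bsub>Zd_group d\<^esub> \<Phi> x (Suc j)"
        unfolding set_mult_Zd using v by blast
    qed
  qed
  have chain: "subgroup_chain d G"
    unfolding subgroup_chain_def
  proof (intro allI conjI)
    fix j
    have G_mem: "u \<in> G j \<longleftrightarrow> u \<in> Zd d \<and> \<pi> j (S u x0) = \<pi> j x0" for u
      by (simp add: G_def mem)
    have G_shift: "G j #>\<^bsub>Zd_group d\<^esub> v = G j" if "v \<in> G j" for v
      using that coset[of v j] by (simp add: G_mem) (simp add: G_def \<Phi>_def)
    have zero: "0 \<in> G j" using is_action_zero[OF S x0] by (simp add: G_mem)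
    show "subgroup (G j) (Zd_group d)"
      unfolding subgroup_Zd_iff
    proof (intro conjI ballI)
      show "u + v \<in> G j" if "u \<in> G j" "v \<in> G j" for u v
        using that G_shift[of v] mem_r_coset_Zd[of "u + v" d "G j" v] by simp
      show "- u \<in> G j" if "u \<in> G j" for u
        using G_shift[OF that] zero mem_r_coset_Zd[of 0 d "G j" u] by simp
    qed (use zero in \<open>auto simp: G_mem\<close>)
    show "finite (rcosets\<^bsub>Zd_group d\<^esub> (G j))"
    proof (rule finite_subset)
      show "rcosets\<^bsub>Zd_group d\<^esub> (G j) \<subseteq> K j ` \<pi> j ` topspace X"
        using coset SX x0 by (auto simp: rcosets_Zd \<Phi>_def)
    qed (simp add: tower_finite_range[OF tw])
    show "G (Suc j) \<subseteq> G j"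
      using tower_refines[OF tw _ SX[OF _ x0] x0, of j "Suc j"] by (auto simp: G_def mem)
  qed
  let ?Y = "odometer_space d G"
  have \<Phi>_in: "\<Phi> x \<in> topspace ?Y" if x: "x \<in> topspace X" for x
  proof -
    have "\<Phi> x j \<in> rcosets\<^bsub>Zd_group d\<^esub> (G j)" for j
    proof -
      obtain v where "v \<in> Zd d" "\<pi> j (S v x0) = \<pi> j x" using approx[OF x] by blast
      then show ?thesis using coset[of v j] by (auto simp: rcosets_Zd \<Phi>_def)
    qed
    then show ?thesis using mult[OF x] by (simp add: topspace_odometer)
  qed
  have \<Phi>_eq: "\<pi> j x = \<pi> j y" if "x \<in> topspace X" "\<Phi> x j = \<Phi> y j" for x y j
    using approx[OF that(1), of j] that(2) mem[of _ x j] mem[of _ y j] by metis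
  have "homeomorphic_map X ?Y \<Phi>"
  proof (rule continuous_imp_homeomorphic_map)
    have "continuous_map X (discrete_topology (rcosets\<^bsub>Zd_group d\<^esub> (G j))) (\<lambda>x. \<Phi> x j)" for j
    proof -
      have "openin X {x \<in> topspace X. \<Phi> x j \<in> U}" for U
        using tower_open[OF tw, of j "K j -` U"] by (simp add: \<Phi>_def)
      with \<Phi>_in show ?thesis
        by (auto simp: continuous_map_def topspace_odometer)
    qed
    with \<Phi>_in show "continuous_map X ?Y \<Phi>"
      by (intro continuous_map_into_odometer)
    show "compact_space X" by (rule tower_compact[OF tw])
    show "Hausdorff_space ?Y" by (rule Hausdorff_odometer)
    show "inj_on \<Phi> (topspace X)"
      using \<Phi>_eq tower_separates[OF tw] by (metis inj_onI)
    show "\<Phi> ` topspace X = topspace ?Y"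
    proof (intro equalityI subsetI)
      fix c assume c: "c \<in> topspace ?Y"
      define C where "C j = {x \<in> topspace X. \<Phi> x j = c j}" for j
      have "closedin X (C j)" for j
        using tower_closed[OF tw, of j "K j -` {c j}"] by (simp add: C_def \<Phi>_def)
      moreover have "C j \<noteq> {}" for j
      proof -
        obtain v where "v \<in> Zd d" "c j = G j #>\<^bsub>Zd_group d\<^esub> v" by (rule odometer_cosetE[OF c])
        then have "S v x0 \<in> C j" using coset SX x0 by (simp add: C_def)
        then show ?thesis by blast
      qed
      moreover have "decseq C"
      proof (rule decseq_SucI, rule subsetI)
        fix j x assume "x \<in> C (Suc j)"
        moreover have "G j <#>\<^bsub>Zd_group d\<^esub> c (Suc j) = c j"
          using c by (simp add: topspace_odometer)
        ultimately show "x \<in> C j" using mult[of x j] by (simp add: C_def)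
      qed
      ultimately have "(\<Inter>j. C j) \<noteq> {}"
        by (rule compact_space_imp_nest[OF tower_compact[OF tw]])
      then obtain x where "\<And>j. x \<in> C j" by blast
      then have "x \<in> topspace X" "\<Phi> x = c" by (auto simp: C_def)
      then show "c \<in> \<Phi> ` topspace X" by blast
    qed (use \<Phi>_in in blast)
  qed
  moreover have "\<Phi> (S v x) = odometer_action d v (\<Phi> x)" if "v \<in> Zd d" "x \<in> topspace X" for v x
    using shift[OF that] by (simp add: odometer_action_def fun_eq_iff)
  ultimately have "conjugate_actions d X S ?Y (odometer_action d)"
    unfolding conjugate_actions_def by blast
  with S chain show ?thesis unfolding is_odometer_def by blast
qed

section \<open>Bounded speedups\<close>

text \<open>
  Freeness makes \<open>p x v\<close> the only vector \<open>u\<close> with \<open>T u x = S v x\<close>. Its level sets are therefore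
  equalisers of continuous maps, hence closed, and boundedness leaves only finitely many of them.
\<close>

lemma free_bounded_cocycle_continuous:
  assumes T: "is_action d1 X T" and free: "free_action d1 X T" and haus: "Hausdorff_space X"
    and sp: "is_speedup_via d1 d2 X T S p" and v: "v \<in> Zd d2"
    and bound: "\<And>x i. x \<in> topspace X \<Longrightarrow> i < d1 \<Longrightarrow> \<bar>p x v i\<bar> \<le> B"
  shows "continuous_map X (discrete_topology UNIV) (\<lambda>x. p x v)"
proof -
  have S: "is_action d2 X S" and pZ: "\<And>x. x \<in> topspace X \<Longrightarrow> p x v \<in> Zd d1"
    and Sp: "\<And>x. x \<in> topspace X \<Longrightarrow> S v x = T (p x v) x"
    using sp v unfolding is_speedup_via_def is_cocycle_def by blast+
  have "(\<lambda>x. p x v) ` topspace X \<subseteq> {u \<in> Zd d1. \<forall>i<d1. u i \<in> {- B..B}}"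
    using bound pZ by (force simp: abs_le_iff)
  then have fin: "finite ((\<lambda>x. p x v) ` topspace X)"
    using finite_subset finite_Zd_box[of d1 "\<lambda>_. {- B..B}"] by blast
  have level: "{x \<in> topspace X. p x v = u} = {x \<in> topspace X. T u x = S v x}" if u: "u \<in> Zd d1" for u
  proof -
    have "p x v = u" if x: "x \<in> topspace X" and eq: "T u x = T (p x v) x" for x
    proof -
      have "T (- u + p x v) x = T (- u) (T u x)"
        using is_action_add[OF T Zd_uminus[OF u] pZ[OF x] x] eq by simp
      also have "\<dots> = x"
        using is_action_add[OF T Zd_uminus[OF u] u x] is_action_zero[OF T x] by simp
      finally have "- u + p x v = 0"
        using free x u pZ[OF x] unfolding free_action_def by blast
      then show ?thesis by (simp add: neg_eq_iff_add_eq_0[symmetric])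
    qed
    then show ?thesis using Sp by auto
  qed
  have level_closed: "closedin X {x \<in> topspace X. p x v = u}" if u: "u \<in> Zd d1" for u
    unfolding level[OF u]
    by (rule closedin_continuous_maps_eq[OF haus is_action_continuous[OF T u]
          is_action_continuous[OF S v]])
  have "closedin X {x \<in> topspace X. p x v \<in> C}" for C
  proof -
    have "{x \<in> topspace X. p x v \<in> C} =
        (\<Union>u \<in> (\<lambda>x. p x v) ` topspace X \<inter> C. {x \<in> topspace X. p x v = u})"
      by auto
    moreover have "closedin X \<dots>"
      using fin level_closed pZ by (intro closedin_Union) auto
    ultimately show ?thesis by simp
  qed
  then show ?thesis
    by (simp add: continuous_map_closedin)
qed

text \<open>
  The cocycle only depends on a sufficiently high coordinate of the point. How high may vary with
  the vector, but vectors that act on the cells of one level compose, so a level that works for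
  the generators and their negatives works for all vectors. The tower that starts at this level is
  invariant.
\<close>

theorem bounded_speedup_odometer:
  assumes T: "is_odometer d1 X T" and free: "free_action d1 X T"
    and sp: "bounded_speedup d1 d2 X T S" and min: "minimal_action d2 X S"
  shows "is_odometer d2 X S"
proof -
  from T obtain G where T_act: "is_action d1 X T" and G: "subgroup_chain d1 G"
    and "conjugate_actions d1 X T (odometer_space d1 G) (odometer_action d1)"
    unfolding is_odometer_def by blast
  then obtain \<Phi> where hom: "homeomorphic_map X (odometer_space d1 G) \<Phi>"
    and conj: "\<And>v x. v \<in> Zd d1 \<Longrightarrow> x \<in> topspace X \<Longrightarrow> \<Phi> (T v x) = odometer_action d1 v (\<Phi> x)"
    unfolding conjugate_actions_def by blast
  from sp obtain p where via: "is_speedup_via d1 d2 X T S p"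
    and bound: "\<And>v. v \<in> Zd d2 \<Longrightarrow> \<exists>B. \<forall>x\<in>topspace X. \<forall>i<d1. \<bar>p x v i\<bar> \<le> B"
    unfolding bounded_speedup_def by blast
  then have S: "is_action d2 X S"
    and pZ: "\<And>x v. v \<in> Zd d2 \<Longrightarrow> x \<in> topspace X \<Longrightarrow> p x v \<in> Zd d1"
    and Sp: "\<And>x v. v \<in> Zd d2 \<Longrightarrow> x \<in> topspace X \<Longrightarrow> S v x = T (p x v) x"
    unfolding is_speedup_via_def is_cocycle_def by blast+
  have tw: "tower X (\<lambda>j x. \<Phi> x j)"
    using tower_pullback[OF hom tower_odometer[OF G]] .
  have haus: "Hausdorff_space X" by (rule tower_Hausdorff[OF tw])
  have "topspace X \<noteq> {}"
    using homeomorphic_imp_surjective_map[OF hom] odometer_base_point[OF G] by auto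
  define invariant where
    "invariant m v \<longleftrightarrow> (\<forall>x\<in>topspace X. \<forall>y\<in>topspace X. \<Phi> x m = \<Phi> y m \<longrightarrow> \<Phi> (S v x) m = \<Phi> (S v y) m)"
    for m v
  have "\<exists>n. \<forall>m\<ge>n. invariant m v" if v: "v \<in> Zd d2" for v
  proof -
    obtain B where "\<And>x i. x \<in> topspace X \<Longrightarrow> i < d1 \<Longrightarrow> \<bar>p x v i\<bar> \<le> B"
      using bound[OF v] by blast
    then have "continuous_map X (discrete_topology UNIV) (\<lambda>x. p x v)"
      by (rule free_bounded_cocycle_continuous[OF T_act free haus via v])
    then obtain n where n: "\<And>m x y. n \<le> m \<Longrightarrow> x \<in> topspace X \<Longrightarrow> y \<in> topspace X \<Longrightarrow>
        \<Phi> x m = \<Phi> y m \<Longrightarrow> p x v = p y v"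
      using tower_locally_constant[OF tw] by metis
    have "\<Phi> (S v x) m = \<Phi> x m #>\<^bsub>Zd_group d1\<^esub> p x v" if "x \<in> topspace X" for x m
      using Sp[OF v that] conj[OF pZ[OF v that] that] by (simp add: odometer_action_def)
    with n show ?thesis unfolding invariant_def by (intro exI[of _ n]) metis
  qed
  then obtain N where N: "\<And>v m. v \<in> Zd d2 \<Longrightarrow> N v \<le> m \<Longrightarrow> invariant m v" by metis
  \<comment> \<open>the finitely many generators, whose common level is \<open>n\<close>\<close>
  define E where "E = unit_vec ` {..<d2} \<union> (\<lambda>i. - unit_vec i) ` {..<d2}"
  define n where "n = Max (insert 0 (N ` E))"
  have gen: "invariant m e" if "e \<in> E" "n \<le> m" for e m
  proof -
    have "N e \<le> n" unfolding n_def using that(1) by (intro Max_ge) (auto simp: E_def)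
    moreover have "e \<in> Zd d2" using that(1) unit_vec_Zd by (auto simp: E_def)
    ultimately show ?thesis using N that(2) by simp
  qed
  have step: "invariant m (v + e)" if "invariant m v" "v \<in> Zd d2" "e \<in> Zd d2" "invariant m e" for m v e
    unfolding invariant_def
  proof (intro ballI impI)
    fix x y assume xy: "x \<in> topspace X" "y \<in> topspace X" "\<Phi> x m = \<Phi> y m"
    then have "\<Phi> (S v (S e x)) m = \<Phi> (S v (S e y)) m"
      using that is_action_closed[OF S that(3)] unfolding invariant_def by blast
    then show "\<Phi> (S (v + e) x) m = \<Phi> (S (v + e) y) m"
      using is_action_add[OF S that(2,3)] xy by simp
  qed
  have resp: "invariant m v" if "v \<in> Zd d2" "n \<le> m" for m v
    using that(1)
  proof (induction rule: Zd_induct)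
    case zero
    show ?case unfolding invariant_def by (metis is_action_zero[OF S])
  next
    case (plus v i)
    have "unit_vec i \<in> E" using plus(2) unfolding E_def by blast
    then show ?case
      using step[OF plus(3,1) unit_vec_Zd[OF plus(2)]] gen that(2) by blast
  next
    case (minus v i)
    have "- unit_vec i \<in> E" using minus(2) unfolding E_def by blast
    then have "invariant m (v + - unit_vec i)"
      using step[OF minus(3,1) Zd_uminus[OF unit_vec_Zd[OF minus(2)]]] gen that(2) by blast
    then show ?case by (metis diff_conv_add_uminus)
  qed
  show "is_odometer d2 X S"
  proof (rule invariant_tower_imp_odometer[OF S min \<open>topspace X \<noteq> {}\<close> tower_shift[OF tw, of n]])
    fix j v x y
    assume "v \<in> Zd d2" "x \<in> topspace X" "y \<in> topspace X" "\<Phi> x (n + j) = \<Phi> y (n + j)"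
    then show "\<Phi> (S v x) (n + j) = \<Phi> (S v y) (n + j)"
      using resp[of v "n + j"] le_add1[of n j] unfolding invariant_def by blast
  qed
qed

section \<open>A speedup that is not conjugate to its odometer\<close>

definition lattice23 :: "nat \<Rightarrow> (nat \<Rightarrow> int) set" where
  "lattice23 j = {v \<in> Zd 2. 2 ^ j dvd v 0 \<and> 3 ^ j dvd v 1}"

definition swap :: "(nat \<Rightarrow> int) \<Rightarrow> (nat \<Rightarrow> int)" where
  "swap v = (\<lambda>i. if i = 0 then v 1 else if i = 1 then v 0 else 0)"

lemma swap_add: "swap (v + w) = swap v + swap w"
  by (auto simp: swap_def)

lemma swap_zero [simp]: "swap 0 = 0"
  by (auto simp: swap_def)

lemma swap_Zd [intro]: "swap v \<in> Zd 2"
  by (auto simp: swap_def Zd_def)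

lemma swap_swap:
  assumes "v \<in> Zd 2"
  shows "swap (swap v) = v"
proof
  fix i :: nat
  consider "i = 0" | "i = 1" | "i \<ge> 2" by linarith
  then show "swap (swap v) i = v i"
    by cases (use assms in \<open>auto simp: swap_def Zd_def\<close>)
qed

lemma image_swap_Zd: "swap ` Zd 2 = Zd 2"
  using swap_swap[symmetric] by (auto intro: image_eqI)

lemma subgroup_chain_lattice23: "subgroup_chain 2 lattice23"
  unfolding subgroup_chain_def
proof (intro allI conjI)
  fix j
  show sub: "subgroup (lattice23 j) (Zd_group 2)"
    unfolding subgroup_Zd_iff by (auto simp: lattice23_def)
  show "finite (rcosets\<^bsub>Zd_group 2\<^esub> (lattice23 j))"
  proof (rule finite_subset)
    define M where "M i = (if i = 0 then 2 else 3 :: int) ^ j" for i :: nat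
    let ?box = "{v \<in> Zd 2. \<forall>i<2. v i \<in> {0..<M i}}"
    have "lattice23 j #>\<^bsub>Zd_group 2\<^esub> v \<in> (\<lambda>v. lattice23 j #>\<^bsub>Zd_group 2\<^esub> v) ` ?box"
      if v: "v \<in> Zd 2" for v
    proof (rule image_eqI)
      let ?w = "\<lambda>i. v i mod M i"
      show "?w \<in> ?box" using v by (auto simp: Zd_def M_def)
      then have "v - ?w \<in> lattice23 j"
        using v by (auto simp: lattice23_def M_def Zd_def)
      then show "lattice23 j #>\<^bsub>Zd_group 2\<^esub> v = lattice23 j #>\<^bsub>Zd_group 2\<^esub> ?w"
        by (simp add: r_coset_Zd_eq_iff[OF sub])
    qed
    then show "rcosets\<^bsub>Zd_group 2\<^esub> (lattice23 j) \<subseteq> (\<lambda>v. lattice23 j #>\<^bsub>Zd_group 2\<^esub> v) ` ?box"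
      by (auto simp: rcosets_Zd)
    show "finite ((\<lambda>v. lattice23 j #>\<^bsub>Zd_group 2\<^esub> v) ` ?box)"
      by (intro finite_imageI finite_Zd_box) simp
  qed
  show "lattice23 (Suc j) \<subseteq> lattice23 j"
    by (auto simp: lattice23_def dest: dvd_mult_right)
qed

lemma dvd_all_powers_imp_zero:
  fixes a b :: int
  assumes "1 < b" "\<And>j. b ^ j dvd a"
  shows "a = 0"
proof (rule ccontr)
  assume "a \<noteq> 0"
  let ?k = "nat \<bar>a\<bar>"
  have "int ?k < 2 ^ ?k" by (rule of_nat_less_two_power)
  also have "(2 :: int) ^ ?k \<le> b ^ ?k" using assms(1) by (intro power_mono) auto
  also have "b ^ ?k \<le> \<bar>b ^ ?k\<bar>" by simp
  also have "\<dots> \<le> \<bar>a\<bar>" by (rule dvd_imp_le_int[OF \<open>a \<noteq> 0\<close> assms(2)])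
  finally show False by simp
qed

lemma Inter_lattice23: "(\<Inter>j. lattice23 j) = {0}"
proof (intro equalityI subsetI)
  fix v assume "v \<in> (\<Inter>j. lattice23 j)"
  then have "v \<in> Zd 2" "\<And>j. 2 ^ j dvd v 0" "\<And>j. 3 ^ j dvd v 1" by (auto simp: lattice23_def)
  then have "v \<in> Zd 2" "v 0 = 0" "v 1 = 0"
    using dvd_all_powers_imp_zero[of 2 "v 0"] dvd_all_powers_imp_zero[of 3 "v 1"] by auto
  have "v i = 0" for i
  proof -
    consider "i = 0" | "i = 1" | "i \<ge> 2" by linarith
    then show ?thesis by cases (use \<open>v \<in> Zd 2\<close> \<open>v 0 = 0\<close> \<open>v 1 = 0\<close> in \<open>auto simp: Zd_def\<close>)
  qed
  then show "v \<in> {0}" by auto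
qed (auto simp: lattice23_def)

text \<open>
  The vectors \<open>(2^n, 0)\<close> act by maps that converge to the identity pointwise, and a conjugacy
  would carry this convergence over to the swapped action. But \<open>swap (2^n, 0) = (0, 2^n)\<close> moves every point out of its cell of level 1.
\<close>

lemma swapped_odometer_not_conjugate:
  defines "X \<equiv> odometer_space 2 lattice23"
  shows "\<not> conjugate_actions 2 X (\<lambda>v. odometer_action 2 (swap v)) X (odometer_action 2)"
proof
  assume "conjugate_actions 2 X (\<lambda>v. odometer_action 2 (swap v)) X (odometer_action 2)"
  then obtain \<Phi> where hom: "homeomorphic_map X X \<Phi>"
    and conj: "\<And>v x. v \<in> Zd 2 \<Longrightarrow> x \<in> topspace X \<Longrightarrow>
      \<Phi> (odometer_action 2 (swap v) x) = odometer_action 2 v (\<Phi> x)"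
    unfolding conjugate_actions_def by blast
  have tw: "tower X (\<lambda>j x. x j)"
    unfolding X_def by (rule tower_odometer[OF subgroup_chain_lattice23])
  define x where "x = lattice23"
  have x: "x \<in> topspace X"
    unfolding x_def X_def by (rule odometer_base_point[OF subgroup_chain_lattice23])
  define U where "U = {z \<in> topspace X. z 1 \<in> {x 1}}"
  have "openin X U" unfolding U_def by (rule tower_open[OF tw])
  then have "openin X (\<Phi> ` U)"
    using homeomorphic_imp_open_map[OF hom] by (simp add: open_map_def)
  moreover have "\<Phi> x \<in> \<Phi> ` U" using x by (simp add: U_def)
  ultimately obtain n where n: "\<And>y. y \<in> topspace X \<Longrightarrow> y n = \<Phi> x n \<Longrightarrow> y \<in> \<Phi> ` U"
    using tower_neighbourhood[OF tw] by metis
  \<comment> \<open>\<open>v\<close> lies in \<open>lattice23 n\<close> and so fixes the cell of level \<open>n\<close>, while \<open>swap v\<close> is not in \<open>lattice23 1\<close>\<close>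
  define v :: "nat \<Rightarrow> int" where "v = (\<lambda>i. if i = 0 then 2 ^ n else 0)"
  have v: "v \<in> Zd 2" "v \<in> lattice23 n" by (auto simp: v_def Zd_def lattice23_def)
  have y: "\<Phi> x \<in> topspace X" using homeomorphic_imp_surjective_map[OF hom] x by blast
  have "odometer_action 2 v (\<Phi> x) n = \<Phi> x n"
  proof -
    obtain w where w: "\<Phi> x n = lattice23 n #>\<^bsub>Zd_group 2\<^esub> w"
      using odometer_cosetE y unfolding X_def by metis
    show ?thesis
      using v(2) r_coset_Zd_eq_iff[OF subgroup_chain_subgroup[OF subgroup_chain_lattice23]]
      by (simp add: odometer_action_def w r_coset_Zd_add)
  qed
  moreover have "odometer_action 2 v (\<Phi> x) \<in> topspace X"
    using odometer_action_closed v(1) y unfolding X_def by blast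
  ultimately have "odometer_action 2 v (\<Phi> x) \<in> \<Phi> ` U" using n by blast
  then obtain z where z: "z \<in> U" "\<Phi> (odometer_action 2 (swap v) x) = \<Phi> z"
    using conj[OF v(1) x] by auto
  moreover have "odometer_action 2 (swap v) x \<in> topspace X"
    using odometer_action_closed[OF swap_Zd] x unfolding X_def by blast
  ultimately have "odometer_action 2 (swap v) x \<in> U"
    using homeomorphic_imp_injective_map[OF hom] by (metis (no_types, lifting) U_def inj_onD mem_Collect_eq)
  then have "lattice23 1 #>\<^bsub>Zd_group 2\<^esub> swap v = lattice23 1 #>\<^bsub>Zd_group 2\<^esub> 0"
    by (simp add: U_def odometer_action_def x_def)
  then have "swap v \<in> lattice23 1"
    using r_coset_Zd_eq_iff[OF subgroup_chain_subgroup[OF subgroup_chain_lattice23]] by fastforce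
  then have "(3 :: int) dvd 2 ^ n" by (simp add: lattice23_def swap_def v_def)
  moreover have "coprime (3 :: int) (2 ^ n)" by simp
  ultimately have "is_unit (3 :: int)"
    using coprime_common_divisor[OF _ dvd_refl] by blast
  then show False by simp
qed

theorem swapped_odometer_speedup:
  defines "X \<equiv> odometer_space 2 lattice23"
  defines "S \<equiv> (\<lambda>v. odometer_action 2 (swap v))"
  shows "bounded_speedup 2 2 X (odometer_action 2) S"
    and "minimal_action 2 X S" and "effective_action 2 X S"
proof -
  have T: "is_action 2 X (odometer_action 2)"
    unfolding X_def by (rule odometer_action_is_action)
  have "is_action 2 X S"
    unfolding is_action_def
  proof (intro conjI ballI)
    show "homeomorphic_map X X (S v)" for v
      using T swap_Zd unfolding is_action_def S_def by blast
    show "S (v + w) x = S v (S w x)" if "x \<in> topspace X" for v w x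
      using is_action_add[OF T swap_Zd swap_Zd that] by (simp only: S_def swap_add)
    show "S 0 x = x" if "x \<in> topspace X" for x
      using is_action_zero[OF T that] by (simp only: S_def swap_zero)
  qed
  then have "is_speedup_via 2 2 X (odometer_action 2) S (\<lambda>x v. swap v)"
    unfolding is_speedup_via_def is_cocycle_def by (auto simp: S_def swap_add)
  moreover have "\<exists>B. \<forall>x\<in>topspace X. \<forall>i<2. \<bar>swap v i\<bar> \<le> B" for v
    by (rule exI[of _ "\<bar>v 0\<bar> + \<bar>v 1\<bar>"]) (auto simp: swap_def)
  ultimately show "bounded_speedup 2 2 X (odometer_action 2) S"
    unfolding bounded_speedup_def by blast
  have "(\<lambda>v. S v x) ` Zd 2 = (\<lambda>v. odometer_action 2 v x) ` Zd 2" for x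
    using image_image[of "\<lambda>v. odometer_action 2 v x" swap "Zd 2"] by (simp add: S_def image_swap_Zd)
  then show "minimal_action 2 X S"
    using odometer_minimal[OF subgroup_chain_lattice23] by (simp add: minimal_action_def X_def)
  have "free_action 2 X (odometer_action 2)"
    unfolding X_def by (rule odometer_free[OF subgroup_chain_lattice23 Inter_lattice23])
  then have "swap v = 0" if "v \<in> Zd 2" "\<forall>x\<in>topspace X. S v x = x" for v
    using that odometer_base_point[OF subgroup_chain_lattice23] swap_Zd
    unfolding free_action_def S_def X_def by blast
  then show "effective_action 2 X S"
    unfolding effective_action_def by (metis swap_swap swap_zero)
qed

theorem theoremD:
  shows
    "(\<forall>d1 d2 (X :: 'a topology) T S.
        is_odometer d1 X T \<and> free_action d1 X T \<and>
        bounded_speedup d1 d2 X T S \<and> minimal_action d2 X S \<longrightarrow>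
        is_odometer d2 X S \<and> (effective_action d2 X S \<longrightarrow> free_action d2 X S)) \<and>
     (\<exists>d (X :: (nat \<Rightarrow> (nat \<Rightarrow> int) set) topology) T S.
        is_odometer d X T \<and> free_action d X T \<and>
        bounded_speedup d d X T S \<and> minimal_action d X S \<and> effective_action d X S \<and>
        \<not> conjugate_actions d X S X T)"
proof (intro conjI allI impI; (elim conjE)?)
  fix d1 d2 and X :: "'a topology" and T S
  assume *: "is_odometer d1 X T" "free_action d1 X T" "bounded_speedup d1 d2 X T S"
    "minimal_action d2 X S"
  show S: "is_odometer d2 X S"
    by (rule bounded_speedup_odometer[OF *])
  assume "effective_action d2 X S"
  with S * show "free_action d2 X S"
    using minimal_effective_imp_free is_odometer_Hausdorff
    unfolding is_odometer_def by blast
next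
  show "\<exists>d (X :: (nat \<Rightarrow> (nat \<Rightarrow> int) set) topology) T S.
      is_odometer d X T \<and> free_action d X T \<and>
      bounded_speedup d d X T S \<and> minimal_action d X S \<and> effective_action d X S \<and>
      \<not> conjugate_actions d X S X T"
    by (rule exI[of _ 2], rule exI[of _ "odometer_space 2 lattice23"], intro exI conjI;
        rule odometer_is_odometer[OF subgroup_chain_lattice23]
          odometer_free[OF subgroup_chain_lattice23 Inter_lattice23]
          swapped_odometer_speedup swapped_odometer_not_conjugate)
qed

end
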